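(* Let $k$ be a field of characteristic zero, let $R$ be an integral domain containing $k$, let $n\ge 2$ and let $D\in\mathrm{LND}_R(R^{[n]})$ be linear, where $R^{[n]}$ is the polynomial ring in $n$ variables over $R$. Then $\ker(D)$ is non-rigid.
   Context: For a domain $B\supset R\supset k$, $\mathrm{LND}_R(B)$ is the set of locally nilpotent derivations $D$ of $B$ with $R\subset\ker D$; a derivation $D$ is locally nilpotent if for every $b\in B$ there is a positive integer $m$ with $D^m(b)=0$. $D\in\mathrm{LND}_R(R^{[n]})$ is linear if there is a coordinate system $\{X_1,\dots,X_n\}$ of $R^{[n]}$ over $R$ (that is, $R^{[n]}=R[X_1,\dots,X_n]$) such that each $D(X_i)$, $1\le i\le n$, is a linear homogeneous polynomial in $X_1,\dots,X_n$ (with coefficients in $R$). A domain containing $k$ is rigid if it has no non-zero locally nilpotent derivation, and non-rigid otherwise. *)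

theory Defs
  imports Complex_Main "HOL-Library.Poly_Mapping" "HOL-Library.Cardinality"
begin

text \<open>
  For a finite type \<open>'n\<close> the polynomial ring in \<open>n = CARD('n)\<close> variables over \<open>R\<close> is the
  monoid ring of the exponent vectors \<open>'n \<Rightarrow>\<^sub>0 nat\<close>.  Its subrings (such as kernels of
  derivations) are represented as subsets, and a map \<open>A \<rightarrow> A\<close> on a subring \<open>A\<close> as a function on
  the ambient type whose values outside \<open>A\<close> are irrelevant.
\<close>

type_synonym ('n, 'r) polys = "('n \<Rightarrow>\<^sub>0 nat) \<Rightarrow>\<^sub>0 'r"

definition Const :: "'r::comm_ring_1 \<Rightarrow> ('n, 'r) polys" where
  "Const c = Poly_Mapping.single 0 c"

definition subring_of_type :: "'b::comm_ring_1 set \<Rightarrow> bool" where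
  "subring_of_type A \<longleftrightarrow>
     0 \<in> A \<and> 1 \<in> A \<and> (\<forall>a\<in>A. \<forall>b\<in>A. a + b \<in> A \<and> a - b \<in> A \<and> a * b \<in> A)"

definition ring_embedding :: "('k::comm_ring_1 \<Rightarrow> 'r::comm_ring_1) \<Rightarrow> bool" where
  "ring_embedding \<phi> \<longleftrightarrow>
     inj \<phi> \<and> \<phi> 1 = 1 \<and> (\<forall>a b. \<phi> (a + b) = \<phi> a + \<phi> b \<and> \<phi> (a * b) = \<phi> a * \<phi> b)"

definition derivation_on :: "'b::comm_ring_1 set \<Rightarrow> ('b \<Rightarrow> 'b) \<Rightarrow> bool" where
  "derivation_on A D \<longleftrightarrow>
     (\<forall>a\<in>A. D a \<in> A) \<and>
     (\<forall>a\<in>A. \<forall>b\<in>A. D (a + b) = D a + D b \<and> D (a * b) = a * D b + b * D a)"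

definition locally_nilpotent_on :: "'b::comm_ring_1 set \<Rightarrow> ('b \<Rightarrow> 'b) \<Rightarrow> bool" where
  "locally_nilpotent_on A D \<longleftrightarrow> (\<forall>a\<in>A. \<exists>m>0. (D ^^ m) a = 0)"

definition ker_on :: "'b::comm_ring_1 set \<Rightarrow> ('b \<Rightarrow> 'b) \<Rightarrow> 'b set" where
  "ker_on A D = {a \<in> A. D a = 0}"

definition LND :: "'b::comm_ring_1 set \<Rightarrow> ('b \<Rightarrow> 'b) set" where
  "LND A = {D. derivation_on A D \<and> locally_nilpotent_on A D}"

definition LND_over :: "'b::comm_ring_1 set \<Rightarrow> 'b set \<Rightarrow> ('b \<Rightarrow> 'b) set" where
  "LND_over R A = {D \<in> LND A. R \<subseteq> ker_on A D}"

text \<open>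
  For a domain containing a field of characteristic zero, a locally nilpotent derivation
  automatically vanishes on that field, so no linearity over it is imposed.
\<close>

definition rigid :: "'b::comm_ring_1 set \<Rightarrow> bool" where
  "rigid A \<longleftrightarrow> \<not> (\<exists>D \<in> LND A. \<exists>a\<in>A. D a \<noteq> 0)"

definition eval_at :: "('n::finite \<Rightarrow> ('n, 'r::comm_ring_1) polys) \<Rightarrow> ('n, 'r) polys \<Rightarrow> ('n, 'r) polys" where
  "eval_at X p =
     (\<Sum>m\<in>Poly_Mapping.keys p. Const (Poly_Mapping.lookup p m) * (\<Prod>i\<in>UNIV. X i ^ Poly_Mapping.lookup m i))"

text \<open>
  The range of \<open>eval_at X\<close> is the subalgebra generated by the \<open>X i\<close>, so the next definition says
  that the polynomial ring equals \<open>R[X\<^sub>1, \<dots>, X\<^sub>n]\<close>.  Algebraic independence of the \<open>n\<close> generators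
  is then automatic.
\<close>

definition coordinate_system :: "('n::finite \<Rightarrow> ('n, 'r::comm_ring_1) polys) \<Rightarrow> bool" where
  "coordinate_system X \<longleftrightarrow> range (eval_at X) = UNIV"

definition linear_derivation :: "(('n::finite, 'r::comm_ring_1) polys \<Rightarrow> ('n, 'r) polys) \<Rightarrow> bool" where
  "linear_derivation D \<longleftrightarrow>
     (\<exists>X. coordinate_system X \<and>
        (\<forall>i. \<exists>c :: 'n \<Rightarrow> 'r. D (X i) = (\<Sum>j\<in>UNIV. Const (c j) * X j)))"

lemma subring_ker_on:
  assumes A: "subring_of_type A" and D: "derivation_on A D"
  shows "subring_of_type (ker_on A D)"
proof -
  have add: "D (a + b) = D a + D b" and mul: "D (a * b) = a * D b + b * D a"
    if "a \<in> A" "b \<in> A" for a b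
    using D that by (auto simp: derivation_on_def)
  have mem: "0 \<in> A" "1 \<in> A" using A by (auto simp: subring_of_type_def)
  have D0: "D 0 = 0" using add[OF mem(1) mem(1)] by simp
  have D1: "D 1 = 0" using mul[OF mem(2) mem(2)] by simp
  have diff: "D (a - b) = D a - D b" if "a \<in> A" "b \<in> A" for a b
    using add[of "a - b" b] that A by (simp add: subring_of_type_def)
  show ?thesis
    using A D0 D1 add mul diff by (auto simp: subring_of_type_def ker_on_def)
qed

end

theory Submission
  imports Defs "HOL-Computational_Algebra.Fraction_Field" "HOL-Analysis.Cartesian_Space"
begin

text \<open>
  Write \<open>B\<close> for the polynomial ring, \<open>X\<^sub>1, \<dots>, X\<^sub>n\<close> for coordinates in which \<open>D\<close> is linear and
  \<open>d\<^sub>i\<close> for the partial derivatives with respect to them.  A non-zero locally nilpotent derivation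
  of \<open>ker D\<close> is found among the derivations of \<open>B\<close> with constant coefficients.  If \<open>D = 0\<close>, each
  \<open>d\<^sub>i\<close> works.

  Otherwise let \<open>m = D\<^sup>k X\<^sub>i\<close> be non-zero with \<open>k\<close> as large as possible; then \<open>k \<ge> 1\<close>, and \<open>m\<close> is
  a linear form in \<open>ker D\<close> with \<open>D l = m\<close> for a linear form \<open>l\<close>.  Choose \<open>j\<close> with \<open>d\<^sub>j m \<noteq> 0\<close>.
  The derivation \<open>E\<close> with \<open>E X\<^sub>i = d\<^sub>j (D\<^sup>k X\<^sub>i)\<close> has constant values on the coordinates,
  hence is locally nilpotent.  It agrees with \<open>d\<^sub>j D\<^sup>k\<close> on all linear forms, so by maximality of
  \<open>k\<close> both \<open>E D\<close> and \<open>D E\<close> vanish on the coordinates: \<open>E\<close> commutes with \<open>D\<close> and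
  therefore acts on \<open>ker D\<close>.  If it is non-zero there, it is the desired derivation.

  If \<open>E\<close> vanishes on \<open>ker D\<close>, it is proportional to \<open>D\<close>, because once \<open>m\<close> is inverted
  every element of \<open>B\<close> is a polynomial in \<open>l\<close> over \<open>ker D\<close>: precisely \<open>m E = s D\<close> with \<open>s = E l\<close>
  (lemma \<open>derivation_vanishing_on_kernel_proportional\<close>), and \<open>s \<noteq> 0\<close> since \<open>E \<noteq> 0\<close>.  Now \<open>d\<^sub>j\<close>
  commutes with \<open>E\<close>, so for \<open>a \<in> ker D\<close> one has \<open>s D (d\<^sub>j a) = m d\<^sub>j (E a) = 0\<close>.  Hence \<open>d\<^sub>j\<close> acts on
  \<open>ker D\<close>, and it is non-zero there because \<open>d\<^sub>j m \<noteq> 0\<close>.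

  A coordinate system is only known to generate \<open>B\<close>, so the existence of the \<open>d\<^sub>i\<close> needs an argument
  (lemma \<open>ex_dual_derivations\<close>).  Expressing the standard variables through the \<open>X\<^sub>i\<close> and applying
  the chain rule gives a left inverse of the Jacobian matrix of \<open>X\<close>.  Over a field a left inverse is
  also a right inverse, and \<open>B\<close> embeds into a field; the right inverse supplies the coefficients of
  the \<open>d\<^sub>i\<close>.
\<close>

section \<open>The polynomial ring embeds into a field\<close>

lemma poly_mapping_decompose:
  "p = (\<Sum>m\<in>Poly_Mapping.keys p. Poly_Mapping.single m (Poly_Mapping.lookup p m))"
proof (rule poly_mapping_eqI)
  fix k
  show "Poly_Mapping.lookup p k = Poly_Mapping.lookup
      (\<Sum>m\<in>Poly_Mapping.keys p. Poly_Mapping.single m (Poly_Mapping.lookup p m)) k"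
    by (auto simp: lookup_sum lookup_single when_def in_keys_iff)
qed

lemma poly_mapping_monomial_induct [case_names zero single add]:
  fixes p :: "'a \<Rightarrow>\<^sub>0 'b::comm_monoid_add"
  assumes zero: "P 0" and single: "\<And>m c. P (Poly_Mapping.single m c)"
    and add: "\<And>p q. P p \<Longrightarrow> P q \<Longrightarrow> P (p + q)"
  shows "P p"
proof -
  have "P (\<Sum>m\<in>S. Poly_Mapping.single m (Poly_Mapping.lookup p m))" if "finite S" for S
    using that by (induction S) (auto intro: assms)
  then show ?thesis
    by (subst poly_mapping_decompose) simp
qed

text \<open>
  The homomorphism of monoid rings induced by a map of the exponents.  It is used twice: with
  \<open>nat\<close> as coefficients it renames the variables inside a monomial, and the resulting map of
  monomials is then applied to polynomials.
\<close>

definition push_exponents :: "('a \<Rightarrow> 'c) \<Rightarrow> ('a \<Rightarrow>\<^sub>0 'b::comm_monoid_add) \<Rightarrow> 'c \<Rightarrow>\<^sub>0 'b" where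
  "push_exponents h p = (\<Sum>m\<in>Poly_Mapping.keys p. Poly_Mapping.single (h m) (Poly_Mapping.lookup p m))"

lemma push_exponents_superset:
  assumes "finite S" "Poly_Mapping.keys p \<subseteq> S"
  shows "push_exponents h p = (\<Sum>m\<in>S. Poly_Mapping.single (h m) (Poly_Mapping.lookup p m))"
  unfolding push_exponents_def
  by (rule sum.mono_neutral_left) (use assms in \<open>auto simp: in_keys_iff\<close>)

lemma push_exponents_zero [simp]: "push_exponents h 0 = 0"
  by (simp add: push_exponents_def)

lemma push_exponents_single [simp]:
  "push_exponents h (Poly_Mapping.single m c) = Poly_Mapping.single (h m) c"
  by (simp add: push_exponents_def)

lemma push_exponents_add:
  "push_exponents h (p + q) = push_exponents h p + push_exponents h q"
proof -
  let ?S = "Poly_Mapping.keys p \<union> Poly_Mapping.keys q"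
  have "push_exponents h (p + q) =
      (\<Sum>m\<in>?S. Poly_Mapping.single (h m) (Poly_Mapping.lookup (p + q) m))"
    by (rule push_exponents_superset) (auto simp: keys_add)
  moreover have "push_exponents h p = (\<Sum>m\<in>?S. Poly_Mapping.single (h m) (Poly_Mapping.lookup p m))"
    by (rule push_exponents_superset) auto
  moreover have "push_exponents h q = (\<Sum>m\<in>?S. Poly_Mapping.single (h m) (Poly_Mapping.lookup q m))"
    by (rule push_exponents_superset) auto
  ultimately show ?thesis
    by (simp add: lookup_add single_add sum.distrib)
qed

lemma push_exponents_mult:
  fixes p q :: "'a::monoid_add \<Rightarrow>\<^sub>0 'b::comm_ring_1" and h :: "'a \<Rightarrow> 'c::monoid_add"
  assumes "\<And>m n. h (m + n) = h m + h n"
  shows "push_exponents h (p * q) = push_exponents h p * push_exponents h q"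
proof (induction p rule: poly_mapping_monomial_induct)
  case (single m c)
  show ?case
    by (induction q rule: poly_mapping_monomial_induct)
      (simp_all add: mult_single assms push_exponents_add distrib_left)
qed (simp_all add: push_exponents_add distrib_right)

lemma lookup_push_exponents:
  assumes "inj h"
  shows "Poly_Mapping.lookup (push_exponents h p) (h m) = Poly_Mapping.lookup p m"
  by (auto simp: push_exponents_def lookup_sum lookup_single when_def inj_eq[OF assms] in_keys_iff)

lemma ring_embedding_push_exponents:
  fixes h :: "'a::comm_monoid_add \<Rightarrow> 'c::comm_monoid_add"
  assumes "inj h" "\<And>m n. h (m + n) = h m + h n" "h 0 = 0"
  shows "ring_embedding (push_exponents h :: ('a \<Rightarrow>\<^sub>0 'b::comm_ring_1) \<Rightarrow> _)"
proof -
  have "inj (push_exponents h :: ('a \<Rightarrow>\<^sub>0 'b) \<Rightarrow> _)"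
    by (metis (no_types, lifting) injI poly_mapping_eqI lookup_push_exponents[OF \<open>inj h\<close>])
  moreover have "push_exponents h 1 = (1 :: 'c \<Rightarrow>\<^sub>0 'b)"
    by (metis push_exponents_single single_one assms(3))
  ultimately show ?thesis
    by (simp add: ring_embedding_def push_exponents_add push_exponents_mult assms(2))
qed


text \<open>
  Over a linearly ordered monoid of exponents the monoid ring of a domain is a domain.  The type
  \<open>'n\<close> carries no order, so the variables are first numbered by an injection into \<open>nat\<close>.
\<close>

lemma ex_ring_embedding_field:
  "\<exists>T :: ('n::finite, 'r::idom) polys \<Rightarrow> ((nat \<Rightarrow>\<^sub>0 nat) \<Rightarrow>\<^sub>0 'r) fract. ring_embedding T"
proof -
  obtain idx :: "'n \<Rightarrow> nat" where idx: "inj idx"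
    using finite_imp_inj_to_nat_seg[of "UNIV :: 'n set"] by auto
  define h :: "('n \<Rightarrow>\<^sub>0 nat) \<Rightarrow> (nat \<Rightarrow>\<^sub>0 nat)" where "h = push_exponents idx"
  have "inj h"
    unfolding h_def by (metis (no_types, lifting) injI poly_mapping_eqI lookup_push_exponents[OF idx])
  moreover have "h (m + n) = h m + h n" for m n
    by (simp add: h_def push_exponents_add)
  ultimately have "ring_embedding (push_exponents h :: ('n, 'r) polys \<Rightarrow> _)"
    by (rule ring_embedding_push_exponents) (simp add: h_def)
  then have "ring_embedding (\<lambda>p :: ('n, 'r) polys. Fract (push_exponents h p) 1)"
    by (auto simp: ring_embedding_def inj_def eq_fract One_fract_def)
  then show ?thesis
    by blast
qed

lemma ring_embedding_zero: "ring_embedding T \<Longrightarrow> T 0 = 0"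
  unfolding ring_embedding_def by (metis add_cancel_right_left)

lemma ring_embedding_sum: "ring_embedding T \<Longrightarrow> T (sum f S) = (\<Sum>x\<in>S. T (f x))"
  by (induction S rule: infinite_finite_induct)
    (simp_all add: ring_embedding_zero, simp add: ring_embedding_def)

lemma ring_embedding_of_nat: "ring_embedding T \<Longrightarrow> T (of_nat n) = of_nat n"
  by (induction n) (simp_all add: ring_embedding_zero, simp add: ring_embedding_def)

lemma polys_no_zero_divisors:
  fixes a b :: "('n::finite, 'r::idom) polys"
  assumes "a * b = 0"
  shows "a = 0 \<or> b = 0"
proof -
  obtain T :: "('n, 'r) polys \<Rightarrow> ((nat \<Rightarrow>\<^sub>0 nat) \<Rightarrow>\<^sub>0 'r) fract" where T: "ring_embedding T"
    using ex_ring_embedding_field by blast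
  have "T a * T b = 0"
    using T assms ring_embedding_zero[OF T] by (metis ring_embedding_def)
  then show ?thesis
    using T ring_embedding_zero[OF T] by (metis ring_embedding_def inj_eq mult_eq_0_iff)
qed

lemma one_sided_inverse_matrix_commutes:
  fixes T :: "'b::comm_ring_1 \<Rightarrow> 'f::field" and Q J :: "'n::finite \<Rightarrow> 'n \<Rightarrow> 'b"
  assumes T: "ring_embedding T"
    and QJ: "\<And>i k. (\<Sum>j\<in>UNIV. Q i j * J j k) = (if i = k then 1 else 0)"
  shows "(\<Sum>j\<in>UNIV. J i j * Q j k) = (if i = k then 1 else 0)"
proof -
  define M :: "('n \<Rightarrow> 'n \<Rightarrow> 'b) \<Rightarrow> 'f^'n^'n" where "M A = (\<chi> i j. T (A i j))" for A
  have TM: "T (\<Sum>j\<in>UNIV. A i j * B j k) = (M A ** M B) $ i $ k" for A B i k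
    using T by (simp add: ring_embedding_sum matrix_matrix_mult_def M_def) (simp add: ring_embedding_def)
  have T01: "T 0 = 0" "T 1 = 1"
    using T by (auto simp: ring_embedding_zero ring_embedding_def)
  have "M Q ** M J = mat 1"
    by (simp add: vec_eq_iff TM[symmetric] QJ mat_def T01)
  then have "M J ** M Q = mat 1"
    by (rule matrix_left_right_inverse1)
  then have "T (\<Sum>j\<in>UNIV. J i j * Q j k) = T (if i = k then 1 else 0)"
    by (simp add: TM mat_def T01)
  then show ?thesis
    using T by (auto simp: ring_embedding_def inj_eq)
qed


section \<open>Derivations of commutative rings\<close>

lemma derivation_add: "derivation_on UNIV D \<Longrightarrow> D (a + b) = D a + D b"
  by (simp add: derivation_on_def)

lemma derivation_mult: "derivation_on UNIV D \<Longrightarrow> D (a * b) = a * D b + b * D a"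
  by (simp add: derivation_on_def)

lemma derivation_zero: "derivation_on UNIV D \<Longrightarrow> D 0 = 0"
  using derivation_add[of D 0 0] by simp

lemma derivation_one: "derivation_on UNIV D \<Longrightarrow> D 1 = 0"
  using derivation_mult[of D 1 1] by simp

lemma derivation_diff: "derivation_on UNIV D \<Longrightarrow> D (a - b) = D a - D b"
  using derivation_add[of D "a - b" b] by simp

lemma derivation_sum: "derivation_on UNIV D \<Longrightarrow> D (sum f S) = (\<Sum>x\<in>S. D (f x))"
  by (induction S rule: infinite_finite_induct) (simp_all add: derivation_zero derivation_add)

lemma derivation_of_nat: "derivation_on UNIV D \<Longrightarrow> D (of_nat n) = 0"
  by (induction n) (simp_all add: derivation_zero derivation_one derivation_add)

lemma derivation_funpow_zero: "derivation_on UNIV D \<Longrightarrow> (D ^^ k) 0 = 0"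
  by (induction k) (simp_all add: derivation_zero)

lemma derivation_funpow_add: "derivation_on UNIV D \<Longrightarrow> (D ^^ k) (a + b) = (D ^^ k) a + (D ^^ k) b"
  by (induction k) (simp_all add: derivation_add)

lemma derivation_funpow_diff: "derivation_on UNIV D \<Longrightarrow> (D ^^ k) (a - b) = (D ^^ k) a - (D ^^ k) b"
  by (induction k) (simp_all add: derivation_diff)

lemma derivation_funpow_mono:
  assumes "derivation_on UNIV D" "(D ^^ k) a = 0" "k \<le> k'"
  shows "(D ^^ k') a = 0"
  using assms derivation_funpow_zero[OF assms(1), of "k' - k"]
  by (metis funpow_add comp_apply le_add_diff_inverse2)

lemma derivation_sum_scaled:
  assumes "\<And>i. i \<in> S \<Longrightarrow> derivation_on UNIV (d i)"
  shows "derivation_on UNIV (\<lambda>p. \<Sum>i\<in>S. q i * d i p)"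
  using assms by (simp add: derivation_on_def sum.distrib sum_distrib_left algebra_simps)

lemma derivation_commutator:
  assumes "derivation_on UNIV D" "derivation_on UNIV E"
  shows "derivation_on UNIV (\<lambda>p. D (E p) - E (D p))"
  using assms by (simp add: derivation_on_def algebra_simps)

text \<open>
  This makes the elements killed by some power of a derivation a subring, so that local nilpotency
  can be checked on generators.
\<close>

lemma derivation_funpow_mult_eq_zero:
  assumes D: "derivation_on UNIV D" and "(D ^^ j) x = 0" "(D ^^ k) y = 0"
  shows "(D ^^ (j + k)) (x * y) = 0"
  using assms(2,3)
proof (induction "j + k" arbitrary: j k x y)
  case 0
  then show ?case by simp
next
  case (Suc N)
  show ?case
  proof (cases "j = 0 \<or> k = 0")
    case True
    then show ?thesis
      using Suc.prems by (auto simp: derivation_funpow_zero[OF D])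
  next
    case False
    then obtain j' k' where jk: "j = Suc j'" "k = Suc k'"
      by (metis not0_implies_Suc)
    have "(D ^^ (j + k')) (x * D y) = 0"
      using Suc.hyps(1)[of j k' x "D y"] Suc.hyps(2) Suc.prems jk by (simp add: funpow_swap1)
    moreover have "(D ^^ (j' + k)) (D x * y) = 0"
      using Suc.hyps(1)[of j' k "D x" y] Suc.hyps(2) Suc.prems jk by (simp add: funpow_swap1)
    ultimately have "(D ^^ N) (x * D y) + (D ^^ N) (y * D x) = 0"
      using Suc.hyps(2) jk by (simp add: mult.commute)
    then have "(D ^^ Suc N) (x * y) = 0"
      by (simp add: funpow_Suc_right derivation_mult[OF D] derivation_funpow_add[OF D] del: funpow.simps)
    then show ?thesis
      using Suc.hyps(2) by simp
  qed
qed

text \<open>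
  As \<open>D\<close> sends \<open>l\<close> to the constant \<open>m\<close>, it acts on polynomials in \<open>l\<close> over its kernel as \<open>m\<close> times
  the derivative with respect to \<open>l\<close>.
\<close>

lemma derivation_funpow_slice_power:
  assumes D: "derivation_on UNIV D" and l: "D l = m" and m: "D m = 0" and a: "D a = 0"
  shows "(D ^^ k) (l ^ k * a) = of_nat (fact k) * m ^ k * a"
  using a
proof (induction k arbitrary: a)
  case 0
  then show ?case by simp
next
  case (Suc k)
  have pow: "D (l ^ n) = of_nat n * l ^ (n - 1) * m" for n
  proof (induction n)
    case (Suc n)
    then show ?case
      by (cases n) (simp_all add: derivation_mult[OF D] l algebra_simps)
  qed (simp add: derivation_one[OF D])
  let ?a = "of_nat (Suc k) * (m * a)"
  have "D ?a = 0"
    by (simp only: derivation_mult[OF D] derivation_of_nat[OF D] m Suc.prems) simp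
  then have "(D ^^ k) (l ^ k * ?a) = of_nat (fact k) * m ^ k * ?a"
    by (rule Suc.IH)
  moreover have "D (l ^ Suc k * a) = l ^ k * ?a"
    using pow[of "Suc k"] by (simp only: derivation_mult[OF D] Suc.prems) (simp add: algebra_simps)
  ultimately have "(D ^^ Suc k) (l ^ Suc k * a) = of_nat (fact k) * m ^ k * ?a"
    by (simp add: funpow_Suc_right del: funpow.simps power_Suc)
  then show ?case
    by (simp add: algebra_simps)
qed

text \<open>
  The difference \<open>F\<close> of the two sides is a derivation that vanishes on \<open>ker D\<close> and on the local
  slice \<open>l\<close>.  Up to a factor in \<open>ker D\<close>, every element is a polynomial in \<open>l\<close> over \<open>ker D\<close>, so \<open>F\<close>
  vanishes everywhere.  The induction on the nilpotency order of \<open>b\<close> peels off one power of \<open>l\<close> at a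
  time and thus produces this polynomial implicitly.
\<close>

lemma derivation_vanishing_on_kernel_proportional:
  fixes D E :: "'b::comm_ring_1 \<Rightarrow> 'b"
  assumes domain: "\<And>a b :: 'b. a * b = 0 \<Longrightarrow> a = 0 \<or> b = 0"
    and char0: "\<And>n. n > 0 \<Longrightarrow> of_nat n \<noteq> (0 :: 'b)"
    and D: "derivation_on UNIV D" and nil: "locally_nilpotent_on UNIV D"
    and E: "derivation_on UNIV E"
    and vanish: "\<And>a. D a = 0 \<Longrightarrow> E a = 0"
    and l: "D l = m" "D m = 0" "m \<noteq> 0"
  shows "m * E b = E l * D b"
proof -
  define F where "F = (\<lambda>b. m * E b - E l * D b)"
  have F: "derivation_on UNIV F"
    using D E by (simp add: derivation_on_def F_def algebra_simps)
  have F_ker: "F a = 0" if "D a = 0" for a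
    using that vanish by (simp add: F_def)
  have F_l: "F l = 0"
    by (simp add: F_def l mult.commute)
  have F_l_pow: "F (l ^ k) = 0" for k
    by (induction k) (simp_all add: derivation_one[OF F] derivation_mult[OF F] F_l)
  have "F b = 0" if "(D ^^ k) b = 0" for k b
    using that
  proof (induction k arbitrary: b)
    case 0
    then show ?case by (simp add: derivation_zero[OF F])
  next
    case (Suc k)
    let ?a = "(D ^^ k) b"
    let ?u = "of_nat (fact k) * m ^ k"
    have a: "D ?a = 0"
      using Suc.prems by simp
    have m_pow: "D (m ^ j) = 0" for j
      by (induction j) (simp_all add: derivation_one[OF D] derivation_mult[OF D] l)
    have u: "D ?u = 0"
      by (simp only: derivation_mult[OF D] derivation_of_nat[OF D] m_pow) simp
    have Du: "D (?u * c) = ?u * D c" for c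
      using derivation_mult[OF D, of ?u c] u by simp
    have ub: "(D ^^ j) (?u * b) = ?u * (D ^^ j) b" for j
      by (induction j) (simp_all only: funpow.simps comp_apply Du id_apply)
    \<comment> \<open>The top-order term of \<open>b\<close> is cancelled against the power \<open>l ^ k\<close> of the local slice.\<close>
    have "(D ^^ k) (?u * b - l ^ k * ?a) = 0"
      by (simp only: derivation_funpow_diff[OF D] ub derivation_funpow_slice_power[OF D l(1,2) a]) simp
    then have "F (?u * b - l ^ k * ?a) = 0"
      by (rule Suc.IH)
    moreover have Fu: "F (?u * b) = ?u * F b"
      using derivation_mult[OF F, of ?u b] F_ker[OF u] by simp
    ultimately have "?u * F b = 0"
      by (simp only: derivation_diff[OF F] Fu derivation_mult[OF F, of "l ^ k"] F_ker[OF a] F_l_pow) simp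
    moreover have "m ^ j \<noteq> 0" for j
      by (induction j) (use domain l(3) char0[of 1] in auto)
    moreover have "of_nat (fact k) \<noteq> (0 :: 'b)"
      by (rule char0) simp
    ultimately show ?case
      using domain by blast
  qed
  then have "F b = 0"
    using nil by (metis UNIV_I locally_nilpotent_on_def)
  then show ?thesis
    by (simp add: F_def)
qed

lemma not_rigid_kernelI:
  assumes "derivation_on UNIV E" "locally_nilpotent_on UNIV E"
    and "\<And>a. D a = 0 \<Longrightarrow> D (E a) = 0"
    and "D a = 0" "E a \<noteq> 0"
  shows "\<not> rigid (ker_on UNIV D)"
proof -
  have "E \<in> LND (ker_on UNIV D)"
    using assms by (auto simp: LND_def ker_on_def derivation_on_def locally_nilpotent_on_def)
  then show ?thesis
    using assms(4,5) by (auto simp: rigid_def ker_on_def)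
qed


section \<open>Derivations of the polynomial ring over the coefficients\<close>

definition poly_derivation :: "(('n, 'r::comm_ring_1) polys \<Rightarrow> ('n, 'r) polys) \<Rightarrow> bool" where
  "poly_derivation d \<longleftrightarrow> derivation_on UNIV d \<and> (\<forall>c. d (Const c) = 0)"

definition Var :: "'n \<Rightarrow> ('n, 'r::comm_ring_1) polys" where
  "Var k = Poly_Mapping.single (Poly_Mapping.single k 1) 1"

text \<open>
  The derivation \<open>Y\<^sub>k \<partial>/\<partial>Y\<^sub>k\<close>.  It keeps all exponents, which makes the Leibniz rule an
  identity between monomials; the rule for \<open>\<partial>/\<partial>Y\<^sub>k\<close> follows by cancelling \<open>Y\<^sub>k\<close>.
\<close>

definition euler :: "'n \<Rightarrow> ('n, 'r::comm_ring_1) polys \<Rightarrow> ('n, 'r) polys" where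
  "euler k p = Poly_Mapping.mapp (\<lambda>m c. of_nat (Poly_Mapping.lookup m k) * c) p"

definition partial :: "'n \<Rightarrow> ('n, 'r::comm_ring_1) polys \<Rightarrow> ('n, 'r) polys" where
  "partial k p = Poly_Mapping.map_key ((+) (Poly_Mapping.single k 1)) (euler k p)"

lemma lookup_euler:
  "Poly_Mapping.lookup (euler k p) m = of_nat (Poly_Mapping.lookup m k) * Poly_Mapping.lookup p m"
  by (auto simp: euler_def lookup_mapp when_def in_keys_iff)

lemma euler_single [simp]:
  "euler k (Poly_Mapping.single m c) = Poly_Mapping.single m (of_nat (Poly_Mapping.lookup m k) * c)"
  by (rule poly_mapping_eqI) (auto simp: lookup_euler lookup_single when_def)

lemma euler_zero [simp]: "euler k 0 = 0"
  by (rule poly_mapping_eqI) (simp add: lookup_euler)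

lemma euler_add: "euler k (p + q) = euler k p + euler k q"
  by (rule poly_mapping_eqI) (simp add: lookup_euler lookup_add algebra_simps)

lemma euler_mult: "euler k (p * q) = p * euler k q + q * euler k p"
proof (induction p rule: poly_mapping_monomial_induct)
  case (single m c)
  show ?case
    by (induction q rule: poly_mapping_monomial_induct)
      (simp_all add: mult_single euler_add lookup_add single_add[symmetric] algebra_simps)
qed (simp_all add: euler_add algebra_simps)

lemma inj_plus_exponent: "inj ((+) (Poly_Mapping.single k 1 :: 'n \<Rightarrow>\<^sub>0 nat))"
  by (rule injI) simp

lemma partial_add: "partial k (p + q) = partial k p + partial k q"
  by (simp add: partial_def euler_add map_key_plus[OF inj_plus_exponent] del: One_nat_def)

lemma Var_mult_partial: "Var k * partial k p = euler k p"
proof (induction p rule: poly_mapping_monomial_induct)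
  case zero
  then show ?case
    by (simp add: partial_def map_key_zero[OF inj_plus_exponent] del: One_nat_def)
next
  case (single m c)
  show ?case
  proof (cases "Poly_Mapping.lookup m k = 0")
    case True
    then show ?thesis
      by (simp add: partial_def map_key_zero[OF inj_plus_exponent] del: One_nat_def)
  next
    case False
    define m' where "m' = m - Poly_Mapping.single k 1"
    have m: "m = Poly_Mapping.single k 1 + m'"
      using False
      by (intro poly_mapping_eqI) (auto simp: m'_def lookup_add lookup_minus lookup_single when_def)
    have "partial k (Poly_Mapping.single m c) =
        Poly_Mapping.single m' (of_nat (Poly_Mapping.lookup m k) * c)"
      unfolding partial_def euler_single using map_key_single[OF inj_plus_exponent, of k m'] m by metis
    moreover have "Var k * Poly_Mapping.single m' a = Poly_Mapping.single m a" for a :: 'b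
      unfolding Var_def using m by (simp add: mult_single del: One_nat_def)
    ultimately show ?thesis
      by simp
  qed
next
  case (add p q)
  then show ?case
    by (simp add: partial_add euler_add distrib_left)
qed

lemma Var_cancel:
  fixes a b :: "('n::finite, 'r::idom) polys"
  assumes "Var k * a = Var k * b"
  shows "a = b"
proof -
  have "Var k * (a - b) = 0"
    using assms by (simp add: right_diff_distrib)
  moreover have "(Var k :: ('n, 'r) polys) \<noteq> 0"
    by (metis Var_def lookup_single_eq lookup_zero zero_neq_one)
  ultimately show ?thesis
    using polys_no_zero_divisors by (metis right_minus_eq)
qed

lemma poly_derivation_partial:
  "poly_derivation (partial k :: ('n::finite, 'r::idom) polys \<Rightarrow> _)"
proof -
  have "partial k (p * q) = p * partial k q + q * partial k p" for p q :: "('n, 'r) polys"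
  proof (rule Var_cancel[of k])
    have "Var k * (p * partial k q + q * partial k p) =
        p * (Var k * partial k q) + q * (Var k * partial k p)"
      by (simp add: algebra_simps)
    then show "Var k * partial k (p * q) = Var k * (p * partial k q + q * partial k p)"
      by (simp add: Var_mult_partial euler_mult)
  qed
  moreover have "partial k (Const c) = (0 :: ('n, 'r) polys)" for c
    by (simp add: partial_def Const_def map_key_zero[OF inj_plus_exponent] del: One_nat_def)
  ultimately show ?thesis
    by (simp add: poly_derivation_def derivation_on_def partial_add)
qed

lemma partial_Var:
  "partial k (Var j :: ('n::finite, 'r::idom) polys) = (if k = j then 1 else 0)"
proof (rule Var_cancel[of k])
  show "Var k * partial k (Var j :: ('n, 'r) polys) = Var k * (if k = j then 1 else 0)"
    by (auto simp: Var_mult_partial) (auto simp: Var_def lookup_single)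
qed

lemma Const_0: "Const 0 = 0" and Const_1: "Const 1 = 1"
  by (simp_all add: Const_def single_one)

lemma poly_derivation_Const_mult: "poly_derivation d \<Longrightarrow> d (Const c * p) = Const c * d p"
  by (simp add: poly_derivation_def derivation_mult)

lemma coordinate_system_induct [consumes 1, case_names Const coordinate add mult]:
  assumes X: "coordinate_system X"
    and Const: "\<And>c. P (Const c)" and coordinate: "\<And>i. P (X i)"
    and add: "\<And>p q. P p \<Longrightarrow> P q \<Longrightarrow> P (p + q)"
    and mult: "\<And>p q. P p \<Longrightarrow> P q \<Longrightarrow> P (p * q)"
  shows "P b"
proof -
  have sum: "P (sum f S)" if "\<And>x. P (f x)" for f :: "('a \<Rightarrow>\<^sub>0 nat) \<Rightarrow> _" and S
    by (induction S rule: infinite_finite_induct) (use that Const[of 0] add in \<open>auto simp: Const_0\<close>)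
  have prod: "P (prod f S)" if "\<And>x. P (f x)" for f :: "'a \<Rightarrow> _" and S
    by (induction S rule: infinite_finite_induct) (use that Const[of 1] mult in \<open>auto simp: Const_1\<close>)
  have power: "P (X i ^ n)" for i n
    by (induction n) (use Const[of 1] mult coordinate in \<open>auto simp: Const_1\<close>)
  have "b \<in> range (eval_at X)"
    using X by (simp add: coordinate_system_def)
  then obtain p where "b = eval_at X p"
    by blast
  then show ?thesis
    by (auto simp: eval_at_def intro!: sum mult prod power Const)
qed

text \<open>
  The coefficients \<open>q i\<close> are the partial derivatives of a polynomial expression of \<open>b\<close> in the \<open>X i\<close>.
  What matters is that they are the same for all derivations.
\<close>

lemma poly_derivation_chain_rule:
  assumes X: "coordinate_system X"
  shows "\<exists>q. \<forall>d. poly_derivation d \<longrightarrow> d b = (\<Sum>i\<in>UNIV. q i * d (X i))"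
  using X
proof (induction b rule: coordinate_system_induct)
  case (Const c)
  show ?case
    by (rule exI[of _ "\<lambda>_. 0"]) (simp add: poly_derivation_def)
next
  case (coordinate i)
  show ?case
    by (rule exI[of _ "\<lambda>j. if j = i then 1 else 0"]) (simp add: if_distrib[of "\<lambda>x. x * _"] cong: if_cong)
next
  case (add p q)
  then obtain q1 q2 where "\<forall>d. poly_derivation d \<longrightarrow> d p = (\<Sum>i\<in>UNIV. q1 i * d (X i))"
    "\<forall>d. poly_derivation d \<longrightarrow> d q = (\<Sum>i\<in>UNIV. q2 i * d (X i))"
    by blast
  then show ?case
    by (intro exI[of _ "\<lambda>i. q1 i + q2 i"])
      (auto simp: poly_derivation_def derivation_add distrib_right sum.distrib)
next
  case (mult p q)
  then obtain q1 q2 where "\<forall>d. poly_derivation d \<longrightarrow> d p = (\<Sum>i\<in>UNIV. q1 i * d (X i))"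
    "\<forall>d. poly_derivation d \<longrightarrow> d q = (\<Sum>i\<in>UNIV. q2 i * d (X i))"
    by blast
  then show ?case
    by (intro exI[of _ "\<lambda>i. p * q2 i + q * q1 i"])
      (simp add: poly_derivation_def derivation_mult distrib_right sum.distrib mult.assoc
        flip: sum_distrib_left)
qed

lemma poly_derivation_sum_scaled:
  assumes "\<And>i. i \<in> S \<Longrightarrow> poly_derivation (d i)"
  shows "poly_derivation (\<lambda>p. \<Sum>i\<in>S. q i * d i p)"
  using assms derivation_sum_scaled[of S d q] by (simp add: poly_derivation_def)

text \<open>
  The chain rule, applied to the partial derivatives of the standard variables, says that the matrix
  \<open>Q\<close> of coefficients is a left inverse of the Jacobian matrix of \<open>X\<close>.  The dual derivations exist
  because it is a right inverse as well.
\<close>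

lemma ex_dual_derivations:
  fixes X :: "'n::finite \<Rightarrow> ('n, 'r::idom) polys"
  assumes X: "coordinate_system X"
  obtains d where "\<And>i. poly_derivation (d i)" "\<And>i j. d i (X j) = (if i = j then 1 else 0)"
proof -
  obtain Q :: "'n \<Rightarrow> 'n \<Rightarrow> ('n, 'r) polys" where Q:
    "\<And>j d. poly_derivation d \<Longrightarrow> d (Var j) = (\<Sum>i\<in>UNIV. Q j i * d (X i))"
    using poly_derivation_chain_rule[OF X, of "Var _"] by metis
  obtain T :: "('n, 'r) polys \<Rightarrow> ((nat \<Rightarrow>\<^sub>0 nat) \<Rightarrow>\<^sub>0 'r) fract" where T: "ring_embedding T"
    using ex_ring_embedding_field by blast
  have QJ: "(\<Sum>i\<in>UNIV. Q j i * partial k (X i)) = (if j = k then 1 else 0)" for j k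
    using Q[OF poly_derivation_partial, of k j] by (auto simp: partial_Var)
  have JQ: "(\<Sum>k\<in>UNIV. partial k (X j) * Q k i) = (if j = i then 1 else 0)" for j i
    using one_sided_inverse_matrix_commutes[OF T QJ, of j i] by simp
  show ?thesis
  proof
    show "poly_derivation (\<lambda>p. \<Sum>k\<in>UNIV. Q k i * partial k p)" for i
      by (rule poly_derivation_sum_scaled) (rule poly_derivation_partial)
    show "(\<Sum>k\<in>UNIV. Q k i * partial k (X j)) = (if i = j then 1 else 0)" for i j
      using JQ[of j i] by (auto simp: mult.commute)
  qed
qed

lemma poly_derivation_eq_zeroI:
  assumes X: "coordinate_system X" and d: "poly_derivation d" and "\<And>i. d (X i) = 0"
  shows "d b = 0"
  using poly_derivation_chain_rule[OF X, of b] assms by auto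

lemma poly_derivation_commutes:
  assumes X: "coordinate_system X" and "poly_derivation d" "poly_derivation e"
    and "\<And>i. d (e (X i)) = e (d (X i))"
  shows "d (e b) = e (d b)"
proof -
  have "poly_derivation (\<lambda>p. d (e p) - e (d p))"
    using assms(2,3) by (simp add: poly_derivation_def derivation_commutator derivation_zero)
  then have "d (e b) - e (d b) = 0"
    by (rule poly_derivation_eq_zeroI[OF X]) (simp add: assms)
  then show ?thesis
    by simp
qed

lemma poly_derivation_locally_nilpotentI:
  assumes X: "coordinate_system X" and d: "poly_derivation d" and "\<And>i. d (d (X i)) = 0"
  shows "locally_nilpotent_on UNIV d"
proof -
  have D: "derivation_on UNIV d" and c: "\<And>c. d (Const c) = 0"
    using d by (auto simp: poly_derivation_def)
  have "\<exists>k. (d ^^ k) b = 0" for b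
    using X
  proof (induction b rule: coordinate_system_induct)
    case (Const c)
    show ?case by (rule exI[of _ 1]) (simp add: c)
  next
    case (coordinate i)
    show ?case by (rule exI[of _ 2]) (simp add: assms numeral_2_eq_2)
  next
    case (add p q)
    then obtain j k where "(d ^^ j) p = 0" "(d ^^ k) q = 0" by blast
    then have "(d ^^ (j + k)) (p + q) = 0"
      using derivation_funpow_mono[OF D, of _ _ "j + k"] by (simp add: derivation_funpow_add[OF D])
    then show ?case by blast
  next
    case (mult p q)
    then show ?case
      using derivation_funpow_mult_eq_zero[OF D] by blast
  qed
  then have "\<exists>k>0. (d ^^ k) b = 0" for b
    using derivation_funpow_mono[OF D] by (metis le_add1 zero_less_Suc add.commute plus_1_eq_Suc)
  then show ?thesis
    by (simp add: locally_nilpotent_on_def)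
qed


section \<open>Kernels of linear locally nilpotent derivations\<close>

definition linear_form :: "('n::finite \<Rightarrow> ('n, 'r::comm_ring_1) polys) \<Rightarrow> ('n, 'r) polys \<Rightarrow> bool" where
  "linear_form X g \<longleftrightarrow> (\<exists>c. g = (\<Sum>j\<in>UNIV. Const (c j) * X j))"

lemma Const_add: "Const (a + b) = Const a + Const b" and Const_mult: "Const (a * b) = Const a * Const b"
  by (simp_all add: Const_def single_add mult_single)

lemma linear_form_coordinate: "linear_form X (X i)"
  unfolding linear_form_def
  by (rule exI[of _ "\<lambda>j. if j = i then 1 else 0"])
    (simp add: if_distrib[of Const] if_distrib[of "\<lambda>x. x * _"] Const_0 Const_1 cong: if_cong)

lemma linear_form_add: "linear_form X g \<Longrightarrow> linear_form X h \<Longrightarrow> linear_form X (g + h)"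
  unfolding linear_form_def
  by (elim exE, rule_tac x = "\<lambda>j. c j + ca j" in exI) (simp add: Const_add distrib_right sum.distrib)

lemma linear_form_zero: "linear_form X 0"
  unfolding linear_form_def by (rule exI[of _ "\<lambda>_. 0"]) (simp add: Const_0)

lemma linear_form_Const_mult: "linear_form X g \<Longrightarrow> linear_form X (Const a * g)"
  unfolding linear_form_def
  by (elim exE, rule_tac x = "\<lambda>j. a * c j" in exI) (simp add: Const_mult sum_distrib_left mult.assoc)

lemma linear_form_sum: "(\<And>x. linear_form X (f x)) \<Longrightarrow> linear_form X (sum f S)"
  by (induction S rule: infinite_finite_induct) (auto simp: linear_form_zero linear_form_add)

lemma poly_derivation_linear_form:
  assumes "poly_derivation d"
  shows "d (\<Sum>j\<in>UNIV. Const (c j) * X j) = (\<Sum>j\<in>UNIV. Const (c j) * d (X j))"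
proof -
  have "derivation_on UNIV d"
    using assms by (simp add: poly_derivation_def)
  then show ?thesis
    by (simp add: derivation_sum poly_derivation_Const_mult[OF assms])
qed

theorem theorem4p10:
  fixes \<phi> :: "'k::field_char_0 \<Rightarrow> 'r::idom"
    and D :: "('n::finite, 'r) polys \<Rightarrow> ('n, 'r) polys"
  assumes "ring_embedding \<phi>"
    and "CARD('n) \<ge> 2"
    and "D \<in> LND_over (range Const) UNIV"
    and "linear_derivation D"
  shows "\<not> rigid (ker_on UNIV D)"
proof -
  have D: "derivation_on UNIV D" and nil: "locally_nilpotent_on UNIV D"
    and D_Const: "\<And>c. D (Const c) = 0"
    using assms(3) by (auto simp: LND_over_def LND_def ker_on_def)
  then have PD: "poly_derivation D"
    by (simp add: poly_derivation_def)
  have domain: "a = 0 \<or> b = 0" if "a * b = 0" for a b :: "('n, 'r) polys"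
    using that by (rule polys_no_zero_divisors)
  have char0: "of_nat k \<noteq> (0 :: ('n, 'r) polys)" if "k > 0" for k
  proof -
    have "\<phi> (of_nat k) \<noteq> \<phi> 0"
      using assms(1) that by (metis inj_eq of_nat_eq_0_iff less_irrefl ring_embedding_def)
    then have "of_nat k \<noteq> (0 :: 'r)"
      by (simp add: ring_embedding_of_nat[OF assms(1)] ring_embedding_zero[OF assms(1)])
    then show ?thesis
      by (metis lookup_single_eq lookup_zero single_of_nat)
  qed
  obtain X where X: "coordinate_system X" and X_lin: "\<And>i. linear_form X (D (X i))"
    using assms(4) by (auto simp: linear_derivation_def linear_form_def)
  obtain d where d: "\<And>i. poly_derivation (d i)"
    and dX: "\<And>i j. d i (X j) = (if i = j then 1 else 0)"
    using ex_dual_derivations[OF X] by metis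
  have d_der: "derivation_on UNIV (d i)" and d_Const: "d i (Const c) = 0" for i c
    using d by (auto simp: poly_derivation_def)
  have d_nil: "locally_nilpotent_on UNIV (d i)" for i
    by (rule poly_derivation_locally_nilpotentI[OF X d])
      (simp add: dX derivation_zero[OF d_der] derivation_one[OF d_der])
  have d_form: "d i (\<Sum>j\<in>UNIV. Const (c j) * X j) = Const (c i)" for c i
    by (simp add: poly_derivation_linear_form[OF d] dX if_distrib[of "\<lambda>x. _ * x"] cong: if_cong)
  show ?thesis
  proof (cases "\<forall>i. D (X i) = 0")
    case True
    have D0: "D b = 0" for b
      by (rule poly_derivation_eq_zeroI[OF X PD]) (use True in auto)
    show ?thesis
      by (rule not_rigid_kernelI[OF d_der[of undefined] d_nil, of D "X undefined"])
        (use char0[of 1] in \<open>auto simp: D0 dX\<close>)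
  next
    case False
    have form_step: "linear_form X (D g)" if "linear_form X g" for g
      using that X_lin
      by (auto simp: linear_form_def[of X g] poly_derivation_linear_form[OF PD]
          intro!: linear_form_sum linear_form_Const_mult)
    have form: "linear_form X ((D ^^ k) (X i))" for k i
      by (induction k) (simp_all add: linear_form_coordinate form_step)
    have "\<forall>i. \<exists>n. (D ^^ n) (X i) = 0"
      using nil by (auto simp: locally_nilpotent_on_def)
    then obtain f where f: "\<And>i. (D ^^ f i) (X i) = 0"
      by metis
    have "(D ^^ sum f UNIV) (X i) = 0" for i
      by (rule derivation_funpow_mono[OF D f[of i]]) (simp add: member_le_sum)
    then obtain N where N: "\<forall>i. (D ^^ N) (X i) = 0"
      by blast
    \<comment> \<open>This least \<open>k\<close> is one more than the largest power of \<open>D\<close> that is non-zero on a coordinate;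
      that largest power is \<open>Suc k'\<close> below.\<close>
    define k where "k = (LEAST k. \<forall>i. (D ^^ k) (X i) = 0)"
    have k: "(D ^^ k) (X i) = 0" for i
      using LeastI[of "\<lambda>k. \<forall>i. (D ^^ k) (X i) = 0", OF N] by (simp add: k_def)
    have "k \<noteq> 0"
      using k False derivation_zero[OF D] by (metis funpow_0)
    moreover have "k \<noteq> 1"
      using k False by auto
    ultimately obtain k' where k': "k = Suc (Suc k')"
      by (metis One_nat_def not0_implies_Suc)
    obtain i0 where i0: "(D ^^ Suc k') (X i0) \<noteq> 0"
      using not_less_Least[of "Suc k'" "\<lambda>k. \<forall>i. (D ^^ k) (X i) = 0"] k' by (auto simp: k_def)
    define l where "l = (D ^^ k') (X i0)"
    define m where "m = (D ^^ Suc k') (X i0)"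
    have l: "D l = m" "D m = 0" "m \<noteq> 0"
      using k[of i0] i0 by (simp_all add: l_def m_def k')
    obtain c where c: "m = (\<Sum>j\<in>UNIV. Const (c j) * X j)"
      using form[of "Suc k'" i0] unfolding m_def linear_form_def by blast
    have "\<exists>j. Const (c j) \<noteq> (0 :: ('n, 'r) polys)"
    proof (rule ccontr)
      assume "\<nexists>j. Const (c j) \<noteq> (0 :: ('n, 'r) polys)"
      then have "m = 0"
        by (simp add: c)
      then show False
        using l(3) by simp
    qed
    then obtain j where "Const (c j) \<noteq> (0 :: ('n, 'r) polys)"
      by blast
    then have dj_m: "d j m \<noteq> 0"
      by (simp add: c d_form)
    \<comment> \<open>In matrix terms, with \<open>C\<close> the matrix of \<open>D\<close>, the coefficients of \<open>E\<close> are the \<open>j\<close>-th column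
      of the last non-zero power of \<open>C\<close>, a vector killed by \<open>C\<close>; this is what makes \<open>E\<close>
      commute with \<open>D\<close>.\<close>
    define E where "E = (\<lambda>p. \<Sum>i\<in>UNIV. d j ((D ^^ Suc k') (X i)) * d i p)"
    have PE: "poly_derivation E"
      unfolding E_def by (rule poly_derivation_sum_scaled) (rule d)
    then have E: "derivation_on UNIV E"
      by (simp add: poly_derivation_def)
    have EX: "E (X i) = d j ((D ^^ Suc k') (X i))" for i
      by (simp add: E_def dX if_distrib[of "\<lambda>x. _ * x"] cong: if_cong del: funpow.simps)
    have E_form: "E g = d j ((D ^^ Suc k') g)" if g: "linear_form X g" for g
    proof -
      obtain a where a: "g = (\<Sum>i\<in>UNIV. Const (a i) * X i)"
        using g by (auto simp: linear_form_def)
      have "(D ^^ n) g = (\<Sum>i\<in>UNIV. Const (a i) * (D ^^ n) (X i))" for n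
        by (induction n) (simp_all add: a poly_derivation_linear_form[OF PD])
      from this[of "Suc k'"] show ?thesis
        by (simp only: a poly_derivation_linear_form[OF PE] EX poly_derivation_linear_form[OF d])
    qed
    have EX_const: "\<exists>a. E (X i) = Const a" for i
      using form[of "Suc k'" i] unfolding EX linear_form_def by (metis d_form)
    have E_nil: "locally_nilpotent_on UNIV E"
      by (rule poly_derivation_locally_nilpotentI[OF X PE])
        (metis EX_const PE poly_derivation_def)
    have ED: "E (D b) = D (E b)" for b
    proof (rule poly_derivation_commutes[OF X PE PD])
      fix i
      have "E (D (X i)) = d j ((D ^^ k) (X i))"
        using E_form[OF X_lin] by (simp add: k' funpow_swap1)
      then show "E (D (X i)) = D (E (X i))"
        using EX_const[of i] by (auto simp: k derivation_zero[OF d_der] D_Const)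
    qed
    show ?thesis
    proof (cases "\<exists>a. D a = 0 \<and> E a \<noteq> 0")
      case True
      then obtain a where "D a = 0" "E a \<noteq> 0"
        by blast
      then show ?thesis
        by (intro not_rigid_kernelI[OF E E_nil, of D a]) (simp_all add: ED[symmetric] derivation_zero[OF E])
    next
      case False
      then have vanish: "E a = 0" if "D a = 0" for a
        using that by blast
      have mE: "m * E b = E l * D b" for b
        by (rule derivation_vanishing_on_kernel_proportional[OF domain char0 D nil E vanish l])
      have "E (X i0) \<noteq> 0"
        using dj_m by (simp add: EX m_def)
      then have s: "E l \<noteq> 0"
        using mE[of "X i0"] domain[of m "E (X i0)"] l(3) by auto
      have dE: "d j (E b) = E (d j b)" for b
      proof (rule poly_derivation_commutes[OF X d PE])
        fix i
        show "d j (E (X i)) = E (d j (X i))"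
          using EX_const[of i] by (auto simp: dX d_Const derivation_zero[OF E] derivation_one[OF E])
      qed
      have "D (d j a) = 0" if "D a = 0" for a
      proof -
        have "E l * D (d j a) = m * E (d j a)"
          by (simp add: mE)
        also have "\<dots> = 0"
          using vanish[OF that] by (simp add: dE[symmetric] derivation_zero[OF d_der])
        finally show ?thesis
          using s domain by blast
      qed
      then show ?thesis
        by (intro not_rigid_kernelI[OF d_der[of j] d_nil, of D m]) (use l dj_m in auto)
    qed
  qed
qed

end
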